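(* Fix an integer $d \geq 1$ and a positive integer $n$, and let $\mathcal F$ be a finite family of convex sets in $\mathbb{R}^d$. If the intersection of every $2d$ or fewer members of $\mathcal F$ contains a $1$-thick axis-parallel box containing at least $n$ points of $\mathbb{Z}^d$, then $\bigcap \mathcal F$ contains an axis-parallel box containing at least $n/3^{d-1}$ points of $\mathbb{Z}^d$.
   Context: An axis-parallel box in $\mathbb{R}^d$ is a set $\prod_{i=1}^d [x_i,y_i]$ with $x_i \leq y_i$ for all $i$. A box is called $t$-thick if every edge has length at least $t$, i.e. $y_i - x_i \geq t$ for all $i$. *)

theory Defs
  imports "HOL-Analysis.Analysis"
begin

definition integer_points :: "(real ^ 'd) set" where
  "integer_points = {z. \<forall>i. z $ i \<in> \<int>}"

definition axis_parallel_box :: "(real ^ 'd) set \<Rightarrow> bool" where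
  "axis_parallel_box B \<longleftrightarrow> (\<exists>x y. (\<forall>i. x $ i \<le> y $ i) \<and> B = cbox x y)"

(* The condition x $ i <= y $ i is not redundant for t < 0, where cbox x y could be empty. *)
definition thick_box :: "real \<Rightarrow> (real ^ 'd) set \<Rightarrow> bool" where
  "thick_box t B \<longleftrightarrow>
     (\<exists>x y. (\<forall>i. x $ i \<le> y $ i) \<and> (\<forall>i. t \<le> y $ i - x $ i) \<and> B = cbox x y)"

end

theory Submission imports Defs begin

text \<open>
  Identify a box with the pair of its extreme corners, a point of a space of dimension \<open>2d\<close>. The
  boxes inside a convex set form a convex set there, so Helly's theorem, applied to these sets
  together with the convex hull \<open>H\<close> of the 1-thick boxes with at least \<open>n\<close> lattice points, gives a
  point \<open>z\<close> of \<open>H\<close> whose box lies in \<open>\<Inter>F\<close>; let \<open>B\<close> be the lattice box spanned by the lattice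
  points of that box and \<open>c\<^sub>i\<close> their number in direction \<open>i\<close>. A linear functional shows that an element
  of \<open>H\<close> with sides shorter than \<open>c\<^sub>i + 1\<close> forces
  \<open>n \<le> 3\<^sup>d\<^sup>-\<^sup>1 (c\<^sub>j + 1) \<Prod>\<^sub>i\<^sub>\<noteq>\<^sub>j c\<^sub>i\<close> for every \<open>j\<close>. If all boxes in
  \<open>\<Inter>F\<close> had fewer than \<open>n / 3\<^sup>d\<^sup>-\<^sup>1\<close> lattice points, then none of the \<open>2d\<close> enlargements of \<open>B\<close> by
  one layer would fit in \<open>\<Inter>F\<close>. The \<open>2d\<close> members of \<open>F\<close> excluding them contain a 1-thick box \<open>w\<close> with \<open>n\<close> lattice
  points. Move linearly from \<open>z\<close> to \<open>w\<close> for as long as the moving box contains \<open>B\<close>. It never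
  acquires a new layer, so on arrival at \<open>w\<close> only the lattice points of \<open>B\<close> are available, while an
  earlier stop makes some side shorter than \<open>c\<^sub>j\<close>, and the same bound with \<open>c\<^sub>j - 1\<close> in place of
  \<open>c\<^sub>j\<close> applies.
\<close>

section \<open>Boxes as pairs of corners\<close>

text \<open>The order condition on the corners excludes empty boxes, which would lie in every
  set.\<close>

definition boxes_in :: "(real ^ 'd) set \<Rightarrow> ((real ^ 'd) \<times> (real ^ 'd)) set" where
  "boxes_in C = {z. (\<forall>i. fst z $ i \<le> snd z $ i) \<and> cbox (fst z) (snd z) \<subseteq> C}"

definition thick_boxes :: "nat \<Rightarrow> ((real ^ 'd) \<times> (real ^ 'd)) set" where
  "thick_boxes n = {z. (\<forall>i. 1 \<le> snd z $ i - fst z $ i) \<and>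
     n \<le> card (cbox (fst z) (snd z) \<inter> integer_points)}"

text \<open>A point of the combined box is the same convex combination of the two points at its
  relative position in the two given boxes.\<close>

lemma convex_boxes_in:
  fixes C :: "(real ^ 'd) set"
  assumes "convex C"
  shows "convex (boxes_in C)"
proof (rule convexI)
  fix z w :: "(real ^ 'd) \<times> (real ^ 'd)" and u v :: real
  assume z: "z \<in> boxes_in C" and w: "w \<in> boxes_in C" and uv: "0 \<le> u" "0 \<le> v" "u + v = 1"
  define X where "X = u *\<^sub>R fst z + v *\<^sub>R fst w"
  define Y where "Y = u *\<^sub>R snd z + v *\<^sub>R snd w"
  have le: "fst z $ i \<le> snd z $ i" "fst w $ i \<le> snd w $ i" for i
    using z w by (auto simp: boxes_in_def)
  have XY: "X $ i \<le> Y $ i" for i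
    unfolding X_def Y_def by (simp add: add_mono le mult_left_mono uv)
  have "t \<in> C" if t: "t \<in> cbox X Y" for t
  proof -
    \<comment> \<open>Relative position in direction \<open>i\<close>; for a degenerate side the
      quotient is 0, which still satisfies the equation in \<open>th\<close>.\<close>
    define \<theta> where "\<theta> i = (t $ i - X $ i) / (Y $ i - X $ i)" for i
    have tb: "X $ i \<le> t $ i" "t $ i \<le> Y $ i" for i
      using t by (auto simp: mem_box_cart)
    have th: "0 \<le> \<theta> i" "\<theta> i \<le> 1" "X $ i + \<theta> i * (Y $ i - X $ i) = t $ i" for i
      using tb[of i] XY[of i] by (auto simp: \<theta>_def divide_simps)
    define s where "s = (\<chi> i. fst z $ i + \<theta> i * (snd z $ i - fst z $ i))"
    define s' where "s' = (\<chi> i. fst w $ i + \<theta> i * (snd w $ i - fst w $ i))"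
    have aux: "p \<le> p + a * (q - p)" "p + a * (q - p) \<le> q" if "0 \<le> a" "a \<le> 1" "p \<le> q" for a p q :: real
      using that mult_left_le_one_le[of "q - p" a] by auto
    have "s \<in> cbox (fst z) (snd z)" "s' \<in> cbox (fst w) (snd w)"
      using aux[OF th(1,2) le(1)] aux[OF th(1,2) le(2)] by (auto simp: mem_box_cart s_def s'_def)
    then have "s \<in> C" "s' \<in> C"
      using z w by (auto simp: boxes_in_def)
    then have "u *\<^sub>R s + v *\<^sub>R s' \<in> C"
      using assms uv by (simp add: convex_def)
    moreover have "u *\<^sub>R s + v *\<^sub>R s' = t"
    proof (subst vec_eq_iff, rule allI)
      fix i
      show "(u *\<^sub>R s + v *\<^sub>R s') $ i = t $ i"
        unfolding th(3)[of i, symmetric] by (simp add: s_def s'_def X_def Y_def algebra_simps)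
    qed
    ultimately show ?thesis by simp
  qed
  then show "u *\<^sub>R z + v *\<^sub>R w \<in> boxes_in C"
    using XY by (auto simp: boxes_in_def X_def Y_def)
qed

lemma card_integer_points_cbox:
  fixes x y :: "real ^ 'd"
  shows "card (cbox x y \<inter> integer_points) = (\<Prod>i\<in>UNIV. nat (\<lfloor>y $ i\<rfloor> - \<lceil>x $ i\<rceil> + 1))"
proof -
  let ?f = "\<lambda>g. (\<chi> i. real_of_int (g i)) :: real ^ 'd"
  let ?I = "Pi\<^sub>E UNIV (\<lambda>i. {\<lceil>x $ i\<rceil>..\<lfloor>y $ i\<rfloor>})"
  have "inj_on ?f ?I"
    by (auto simp: inj_on_def vec_eq_iff)
  moreover have "?f ` ?I = cbox x y \<inter> integer_points"
  proof (intro equalityI subsetI)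
    fix z assume "z \<in> ?f ` ?I"
    then show "z \<in> cbox x y \<inter> integer_points"
      by (auto simp: mem_box_cart integer_points_def PiE_def Pi_def ceiling_le_iff le_floor_iff)
  next
    fix z assume z: "z \<in> cbox x y \<inter> integer_points"
    have int: "of_int \<lfloor>z $ i\<rfloor> = z $ i" for i
      using z by (auto simp: integer_points_def)
    have "\<lceil>x $ i\<rceil> \<le> \<lfloor>z $ i\<rfloor> \<and> \<lfloor>z $ i\<rfloor> \<le> \<lfloor>y $ i\<rfloor>" for i
      using z by (auto simp: mem_box_cart floor_mono ceiling_le_iff int)
    then have "(\<lambda>i. \<lfloor>z $ i\<rfloor>) \<in> ?I" by auto
    moreover have "z = ?f (\<lambda>i. \<lfloor>z $ i\<rfloor>)"
      by (simp add: vec_eq_iff int)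
    ultimately show "z \<in> ?f ` ?I" by (intro image_eqI)
  qed
  ultimately have "card (cbox x y \<inter> integer_points) = card ?I"
    using card_image by metis
  then show ?thesis
    by (simp add: card_PiE)
qed

section \<open>Weights of the separating functional\<close>

text \<open>Equality holds at \<open>k = 3\<close>; the case \<open>k = 2\<close> forces
  \<open>b \<le> 3 / 2\<close> and \<open>k = 4\<close> forces \<open>4 / 3 \<le> b\<close>. For
  real \<open>k\<close> near 3 only \<open>b = exp (1 / 3)\<close> would do, so integrality is what
  leaves a choice of \<open>b\<close>.\<close>

lemma nat_le_powr:
  fixes b :: real and k :: nat
  assumes "4 / 3 \<le> b" "b \<le> 3 / 2" "2 \<le> k"
  shows "real k \<le> 3 * b powr (real k - 3)"
proof (cases "k = 2")
  case True
  then show ?thesis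
    using assms by (simp add: powr_minus divide_simps)
next
  case False
  then obtain t where t: "k = 3 + t"
    using assms(3) le_Suc_ex[of 3 k] by auto
  have "1 + real t * (1 / 3) \<le> (1 + 1 / 3) ^ t"
    by (rule Bernoulli_inequality) simp
  also have "\<dots> \<le> b ^ t"
    using assms by (intro power_mono) auto
  finally show ?thesis
    using assms t by (simp add: powr_realpow)
qed

lemma prod_le_powr:
  fixes b :: real and r :: "'a \<Rightarrow> nat"
  assumes "4 / 3 \<le> b" "b \<le> 3 / 2" "finite A" "\<And>i. i \<in> A \<Longrightarrow> 2 \<le> r i"
  shows "(\<Prod>i\<in>A. real (r i)) \<le> 3 ^ card A * b powr (\<Sum>i\<in>A. real (r i) - 3)"
proof -
  have "(\<Prod>i\<in>A. real (r i)) \<le> (\<Prod>i\<in>A. 3 * b powr (real (r i) - 3))"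
    using assms nat_le_powr by (intro prod_mono) auto
  also have "\<dots> = 3 ^ card A * b powr (\<Sum>i\<in>A. real (r i) - 3)"
    using assms by (simp add: prod.distrib powr_sum)
  finally show ?thesis .
qed

text \<open>
  If some \<open>c i\<close> with \<open>i \<noteq> j\<close> is at least 2, the weights come from the AM-GM inequality. Otherwise all
  these \<open>c i\<close> are 1, where AM-GM is too weak and the integrality of the \<open>r i\<close> is essential.
\<close>

lemma separating_weights:
  fixes c :: "'d::finite \<Rightarrow> nat" and j :: 'd
  assumes c: "\<And>i. 1 \<le> c i"
  obtains \<alpha> :: "'d \<Rightarrow> real" where "\<And>i. 0 < \<alpha> i"
    and "\<forall>r :: 'd \<Rightarrow> nat. (\<forall>i. 2 \<le> r i) \<longrightarrow>
      3 ^ (CARD('d) - 1) * ((c j + 1) * (\<Prod>i\<in>UNIV - {j}. c i)) < (\<Prod>i\<in>UNIV. r i) \<longrightarrow>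
      (\<Sum>i\<in>UNIV. \<alpha> i * (real (c i) + 2)) \<le> (\<Sum>i\<in>UNIV. \<alpha> i * real (r i))"
proof (cases "\<exists>i0. i0 \<noteq> j \<and> 2 \<le> c i0")
  case True
  then obtain i0 where i0: "i0 \<noteq> j" "2 \<le> c i0" by blast
  let ?J = "UNIV - {j} - {i0}"
  have split: "(\<Prod>i\<in>UNIV - {j}. g i) = g i0 * (\<Prod>i\<in>?J. g i)" for g :: "'d \<Rightarrow> nat"
    by (rule prod.remove) (use i0 in auto)
  have split': "(\<Prod>i\<in>UNIV. g i) = g j * (\<Prod>i\<in>UNIV - {j}. g i)" for g :: "'d \<Rightarrow> nat"
    by (rule prod.remove) auto
  have card: "CARD('d) - 1 = Suc (card ?J)"
  proof -
    have "Suc (card ?J) = card (UNIV - {j})"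
      by (rule card_Suc_Diff1) (use i0 in auto)
    then show ?thesis by (simp add: card_Diff_singleton)
  qed
  \<comment> \<open>Equality at \<open>c j = 1\<close>, \<open>c i0 = 2\<close>. For
    \<open>c i0 = 1\<close> this would fail, hence the case distinction.\<close>
  have two: "(c j + 2) * (c i0 + 2) \<le> 3 * ((c j + 1) * c i0)"
  proof -
    obtain a where a: "c j = 1 + a" using c[of j] by (auto simp only: le_iff_add)
    obtain b where b: "c i0 = 2 + b" using i0 by (auto simp only: le_iff_add)
    show ?thesis unfolding a b by (simp add: algebra_simps)
  qed
  have rest: "(\<Prod>i\<in>?J. c i + 2) \<le> 3 ^ card ?J * (\<Prod>i\<in>?J. c i)"
  proof -
    have "c i + 2 \<le> 3 * c i" for i using c[of i] by linarith
    then have "(\<Prod>i\<in>?J. c i + 2) \<le> (\<Prod>i\<in>?J. 3 * c i)"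
      by (intro prod_mono) auto
    then show ?thesis by (simp add: prod.distrib)
  qed
  have bound: "(\<Prod>i\<in>UNIV. c i + 2) \<le> 3 ^ (CARD('d) - 1) * ((c j + 1) * (\<Prod>i\<in>UNIV - {j}. c i))"
    unfolding split' split card using mult_mono[OF two rest] by (simp add: algebra_simps)
  \<comment> \<open>AM-GM for the ratios \<open>t i\<close>, in the form
    \<open>ln x \<le> x - 1\<close>: their product is at least 1, so their sum is at least the
    dimension.\<close>
  show ?thesis
  proof (rule that[of "\<lambda>i. 1 / (real (c i) + 2)"]; (intro allI impI)?)
    show "0 < 1 / (real (c i) + 2)" for i by simp
    fix r :: "'d \<Rightarrow> nat"
    assume r: "\<forall>i. 2 \<le> r i"
      and "3 ^ (CARD('d) - 1) * ((c j + 1) * (\<Prod>i\<in>UNIV - {j}. c i)) < (\<Prod>i\<in>UNIV. r i)"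
    then have "(\<Prod>i\<in>UNIV. c i + 2) \<le> (\<Prod>i\<in>UNIV. r i)"
      using bound by linarith
    then have "real (\<Prod>i\<in>UNIV. c i + 2) \<le> real (\<Prod>i\<in>UNIV. r i)"
      by (rule of_nat_mono)
    then have le: "(\<Prod>i\<in>UNIV. real (c i) + 2) \<le> (\<Prod>i\<in>UNIV. real (r i))"
      by (simp add: add.commute)
    define t where "t i = real (r i) / (real (c i) + 2)" for i
    have t: "0 < t i" for i
      unfolding t_def using r[rule_format, of i] by simp
    have "1 \<le> (\<Prod>i\<in>UNIV. t i)"
      unfolding t_def prod_dividef using le by (simp add: prod_pos)
    then have "0 \<le> ln (\<Prod>i\<in>UNIV. t i)" by simp
    also have "\<dots> = (\<Sum>i\<in>UNIV. ln (t i))"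
      using t by (intro ln_prod) (auto simp: less_imp_neq[symmetric] order_less_imp_not_eq2)
    also have "\<dots> \<le> (\<Sum>i\<in>UNIV. t i - 1)"
      using t by (intro sum_mono ln_le_minus_one)
    finally show "(\<Sum>i\<in>UNIV. 1 / (real (c i) + 2) * (real (c i) + 2))
        \<le> (\<Sum>i\<in>UNIV. 1 / (real (c i) + 2) * real (r i))"
      by (simp add: t_def sum_subtractf)
  qed
next
  case False
  then have c1: "c i = 1" if "i \<noteq> j" for i
    using c[of i] that False by (metis One_nat_def Suc_1 le_antisym not_less_eq_eq)
  define m where "m = c j + 1"
  \<comment> \<open>An integer between \<open>m / 4\<close> and \<open>m / 2\<close>, the slopes
    that the Bernoulli bounds below allow; it is an integer so that a strict inequality can later be
    improved by 1.\<close>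
  define h where "h = m div 2"
  have m: "2 \<le> m" using c[of j] by (simp add: m_def)
  have h: "1 \<le> h" "2 * h \<le> m" "m \<le> 4 * h" using m by (auto simp: h_def)
  define \<alpha> where "\<alpha> i = (if i = j then 1 else real h)" for i
  show ?thesis
  proof (rule that[of \<alpha>]; (intro allI impI)?)
    show "0 < \<alpha> i" for i using h by (simp add: \<alpha>_def)
    fix r :: "'d \<Rightarrow> nat"
    assume r: "\<forall>i. 2 \<le> r i"
      and big: "3 ^ (CARD('d) - 1) * ((c j + 1) * (\<Prod>i\<in>UNIV - {j}. c i)) < (\<Prod>i\<in>UNIV. r i)"
    define S where "S = (\<Sum>i\<in>UNIV - {j}. int (r i) - 3)"
    have S: "(\<Sum>i\<in>UNIV - {j}. real (r i) - 3) = real_of_int S"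
      by (simp add: S_def)
    have "3 ^ (CARD('d) - 1) * m < r j * (\<Prod>i\<in>UNIV - {j}. r i)"
      using big c1 prod.remove[of UNIV j r] by (simp add: m_def)
    then have "real (3 ^ (CARD('d) - 1) * m) < real (r j * (\<Prod>i\<in>UNIV - {j}. r i))"
      by (simp only: of_nat_less_iff)
    then have big': "3 ^ (CARD('d) - 1) * real m < real (r j) * (\<Prod>i\<in>UNIV - {j}. real (r i))"
      by simp
    have *: "real m < real (r j) * b powr S" if "4 / 3 \<le> b" "b \<le> 3 / 2" for b :: real
    proof -
      have "(\<Prod>i\<in>UNIV - {j}. real (r i)) \<le> 3 ^ (CARD('d) - 1) * b powr S"
        using prod_le_powr[OF that, of "UNIV - {j}" r] r S by (simp add: card_Diff_singleton)
      then have "real (r j) * (\<Prod>i\<in>UNIV - {j}. real (r i))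
          \<le> real (r j) * (3 ^ (CARD('d) - 1) * b powr S)"
        by (rule mult_left_mono) simp
      with big' have "3 ^ (CARD('d) - 1) * real m < 3 ^ (CARD('d) - 1) * (real (r j) * b powr S)"
        by (simp only: mult_ac)
      then show ?thesis by (simp only: mult_less_cancel_left_pos zero_less_power zero_less_numeral)
    qed
    \<comment> \<open>The base is chosen by the sign of \<open>S\<close> so that
      \<open>b powr S\<close> is smallest: 4/3 for \<open>S \<ge> 0\<close>, 3/2 for
      \<open>S < 0\<close>.\<close>
    have "real m - real h * S < real (r j)"
    proof (cases "0 \<le> S")
      case True
      then obtain s where s: "S = int s" using nonneg_int_cases by blast
      have "real m < real (r j) * (4 / 3) ^ s"
        using *[of "4 / 3"] s by (simp add: powr_realpow)
      then have lt: "real m * (3 / 4) ^ s < real (r j)"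
        by (simp add: field_simps)
      have "1 + real s * (- 1 / 4) \<le> (1 + (- 1 / 4)) ^ s"
        by (rule Bernoulli_inequality) simp
      then have "real m * (1 - real s / 4) \<le> real m * (3 / 4) ^ s"
        by (intro mult_left_mono) auto
      moreover have "real m * real s \<le> real (4 * h) * real s"
        using h by (intro mult_right_mono) auto
      ultimately show ?thesis using lt s by (simp add: algebra_simps)
    next
      case False
      then obtain s where s: "S = - int s" by (metis int_cases2 of_nat_0_le_iff)
      have "real m < real (r j) * inverse ((3 / 2) ^ s)"
        using *[of "3 / 2"] s by (simp add: powr_minus powr_realpow)
      then have lt: "real m * (3 / 2) ^ s < real (r j)"
        by (simp add: field_simps)
      have "1 + real s * (1 / 2) \<le> (1 + 1 / 2) ^ s"
        by (rule Bernoulli_inequality) simp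
      then have "real m * (1 + real s / 2) \<le> real m * (3 / 2) ^ s"
        by (intro mult_left_mono) auto
      moreover have "real (2 * h) * real s \<le> real m * real s"
        using h by (intro mult_right_mono) auto
      ultimately show ?thesis using lt s by (simp add: algebra_simps)
    qed
    \<comment> \<open>Both sides are integers, so strictness yields the extra 1 that turns
      \<open>m\<close> into \<open>c j + 2\<close>.\<close>
    then have "of_int (int m - int h * S) < (of_int (int (r j)) :: real)" by simp
    then have "int m - int h * S < int (r j)" by (simp only: of_int_less_iff)
    then have "int m - int h * S + 1 \<le> int (r j)" by simp
    then have "of_int (int m - int h * S + 1) \<le> (of_int (int (r j)) :: real)" by (simp only: of_int_le_iff)
    then have fin: "real m + 1 \<le> real (r j) + real h * S" by simp
    have "(\<Sum>i\<in>UNIV. \<alpha> i * (real (c i) + 2)) = real m + 1 + (\<Sum>i\<in>UNIV - {j}. real h * 3)"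
      using c1 by (subst sum.remove[of UNIV j]) (simp_all add: \<alpha>_def m_def)
    also have "\<dots> \<le> real (r j) + (\<Sum>i\<in>UNIV - {j}. real h * real (r i))"
      using fin unfolding S[symmetric] by (simp add: sum_subtractf sum_distrib_left algebra_simps)
    also have "\<dots> = (\<Sum>i\<in>UNIV. \<alpha> i * real (r i))"
      by (subst sum.remove[of UNIV j]) (simp_all add: \<alpha>_def)
    finally show "(\<Sum>i\<in>UNIV. \<alpha> i * (real (c i) + 2)) \<le> (\<Sum>i\<in>UNIV. \<alpha> i * real (r i))" .
  qed
qed

section \<open>The convex hull of the thick boxes\<close>

lemma thick_convex_hull_side:
  fixes z :: "(real ^ 'd) \<times> (real ^ 'd)"
  assumes "z \<in> convex hull (thick_boxes n)"
  shows "1 \<le> snd z $ i - fst z $ i"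
proof -
  have "linear (\<lambda>z :: (real ^ 'd) \<times> (real ^ 'd). snd z $ i - fst z $ i)"
    by (rule linearI) (auto simp: algebra_simps)
  from convex_linear_vimage[OF this, of "{1..}"]
  have "convex {z :: (real ^ 'd) \<times> (real ^ 'd). 1 \<le> snd z $ i - fst z $ i}"
    by (simp add: vimage_def)
  then have "convex hull (thick_boxes n) \<subseteq> {z. 1 \<le> snd z $ i - fst z $ i}"
    by (intro hull_minimal) (auto simp: thick_boxes_def)
  then show ?thesis using assms by blast
qed

text \<open>If the bound failed, the weights would give a closed half-space containing all of
  \<open>thick_boxes n\<close>, hence the hull, but not \<open>z\<close>.\<close>

lemma thick_convex_hull_bound:
  fixes z :: "(real ^ 'd) \<times> (real ^ 'd)" and c :: "'d \<Rightarrow> nat"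
  assumes z: "z \<in> convex hull (thick_boxes n)"
    and c: "\<And>i. 1 \<le> c i" and lt: "\<And>i. snd z $ i - fst z $ i < real (c i) + 1"
  shows "n \<le> 3 ^ (CARD('d) - 1) * ((c j + 1) * (\<Prod>i\<in>UNIV - {j}. c i))"
proof (rule ccontr)
  assume "\<not> ?thesis"
  then have n: "3 ^ (CARD('d) - 1) * ((c j + 1) * (\<Prod>i\<in>UNIV - {j}. c i)) < n" by simp
  obtain \<alpha> :: "'d \<Rightarrow> real" where pos: "\<And>i. 0 < \<alpha> i"
    and \<alpha>: "\<forall>r :: 'd \<Rightarrow> nat. (\<forall>i. 2 \<le> r i) \<longrightarrow>
      3 ^ (CARD('d) - 1) * ((c j + 1) * (\<Prod>i\<in>UNIV - {j}. c i)) < (\<Prod>i\<in>UNIV. r i) \<longrightarrow>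
      (\<Sum>i\<in>UNIV. \<alpha> i * (real (c i) + 2)) \<le> (\<Sum>i\<in>UNIV. \<alpha> i * real (r i))"
    using separating_weights[of c j, OF c] by blast
  let ?g = "\<lambda>z :: (real ^ 'd) \<times> (real ^ 'd). \<Sum>i\<in>UNIV. \<alpha> i * (snd z $ i - fst z $ i)"
  let ?t = "\<Sum>i\<in>UNIV. \<alpha> i * (real (c i) + 1)"
  have "?t \<le> ?g w" if w: "w \<in> thick_boxes n" for w
  proof -
    \<comment> \<open>Raising the count to 2 meets the condition on \<open>r\<close> in
      \<open>separating_weights\<close>; since the box is 1-thick, \<open>r i\<close> is still at
      most the side length plus 1.\<close>
    define r where "r i = max 2 (nat (\<lfloor>snd w $ i\<rfloor> - \<lceil>fst w $ i\<rceil> + 1))" for i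
    have "n \<le> (\<Prod>i\<in>UNIV. nat (\<lfloor>snd w $ i\<rfloor> - \<lceil>fst w $ i\<rceil> + 1))"
      using w by (simp add: thick_boxes_def card_integer_points_cbox)
    also have "\<dots> \<le> (\<Prod>i\<in>UNIV. r i)"
      by (intro prod_mono) (auto simp: r_def)
    finally have "(\<Sum>i\<in>UNIV. \<alpha> i * (real (c i) + 2)) \<le> (\<Sum>i\<in>UNIV. \<alpha> i * real (r i))"
      using n by (intro \<alpha>[rule_format]) (auto simp: r_def)
    also have "\<dots> \<le> (\<Sum>i\<in>UNIV. \<alpha> i * (snd w $ i - fst w $ i + 1))"
    proof (intro sum_mono mult_left_mono)
      fix i
      have "1 \<le> snd w $ i - fst w $ i" using w by (auto simp: thick_boxes_def)
      moreover have "of_int \<lfloor>snd w $ i\<rfloor> \<le> snd w $ i" "fst w $ i \<le> of_int \<lceil>fst w $ i\<rceil>"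
        by simp_all
      ultimately show "real (r i) \<le> snd w $ i - fst w $ i + 1"
        unfolding r_def by linarith
    qed (use pos less_imp_le in auto)
    finally have le: "(\<Sum>i\<in>UNIV. \<alpha> i * (real (c i) + 2))
        \<le> (\<Sum>i\<in>UNIV. \<alpha> i * (snd w $ i - fst w $ i + 1))" .
    have "\<alpha> i * (real (c i) + 2) = \<alpha> i * (real (c i) + 1) + \<alpha> i" for i
      by (simp add: algebra_simps)
    moreover have "\<alpha> i * (snd w $ i - fst w $ i + 1) = \<alpha> i * (snd w $ i - fst w $ i) + \<alpha> i" for i
      by (simp add: algebra_simps)
    ultimately show ?thesis using le by (simp only: sum.distrib add_le_cancel_right)
  qed
  moreover have "linear ?g"
    by (rule linearI) (auto simp: algebra_simps sum.distrib sum_subtractf sum_distrib_left)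
  then have "convex {w. ?t \<le> ?g w}"
    using convex_linear_vimage[of ?g "{?t..}"] by (simp add: vimage_def)
  ultimately have "convex hull (thick_boxes n) \<subseteq> {w. ?t \<le> ?g w}"
    by (intro hull_minimal) auto
  then have "?t \<le> ?g z" using z by blast
  moreover have "?g z < ?t"
    using pos lt by (intro sum_strict_mono mult_strict_left_mono) auto
  ultimately show False by simp
qed

section \<open>Helly's theorem for boxes\<close>

lemma Helly_le:
  fixes \<F> :: "'a::euclidean_space set set"
  assumes "finite \<F>" "\<And>S. S \<in> \<F> \<Longrightarrow> convex S"
    and "\<And>\<G>. \<G> \<subseteq> \<F> \<Longrightarrow> card \<G> \<le> DIM('a) + 1 \<Longrightarrow> \<Inter>\<G> \<noteq> {}"
  shows "\<Inter>\<F> \<noteq> {}"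
proof (cases "card \<F> \<le> DIM('a) + 1")
  case True
  then show ?thesis using assms(3) by blast
next
  case False
  show ?thesis
  proof (rule Helly)
    show "DIM('a) + 1 \<le> card \<F>" using False by simp
  qed (use assms in \<open>simp_all\<close>)
qed

text \<open>Helly in dimension 2d tests 2d + 1 sets. If the hull is among them, at most 2d come from
  \<open>F\<close> and \<open>ex\<close> applies; otherwise a degenerate box at a common point of
  \<open>F\<close> serves.\<close>

lemma common_box:
  fixes F :: "(real ^ 'd) set set"
  assumes fin: "finite F" and conv: "\<And>C. C \<in> F \<Longrightarrow> convex C"
    and ex: "\<And>G. G \<subseteq> F \<Longrightarrow> card G \<le> 2 * CARD('d) \<Longrightarrow>
      \<exists>z \<in> thick_boxes n. \<forall>C\<in>G. z \<in> boxes_in C"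
  obtains z where "z \<in> convex hull (thick_boxes n)" "\<And>C. C \<in> F \<Longrightarrow> z \<in> boxes_in C"
proof -
  \<comment> \<open>Helly in dimension d, where d + 1 sets suffice and d + 1 is at most 2d.\<close>
  have "\<Inter>F \<noteq> {}"
  proof (rule Helly_le[OF fin conv])
    fix G assume G: "G \<subseteq> F" "card G \<le> DIM(real ^ 'd) + 1"
    have "0 < CARD('d)" by simp
    moreover have "card G \<le> CARD('d) + 1" using G(2) by simp
    ultimately have "card G \<le> 2 * CARD('d)" by linarith
    then obtain z where z: "\<forall>C\<in>G. z \<in> boxes_in C" using ex G(1) by blast
    have "fst z \<in> C" if "C \<in> G" for C
    proof -
      have "z \<in> boxes_in C" using z that by blast
      moreover from this have "fst z \<in> cbox (fst z) (snd z)"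
        by (auto simp: boxes_in_def mem_box_cart)
      ultimately show ?thesis by (auto simp: boxes_in_def)
    qed
    then show "\<Inter>G \<noteq> {}" by blast
  qed
  then obtain p where "p \<in> \<Inter>F" by blast
  then have p: "(p, p) \<in> boxes_in C" if "C \<in> F" for C
    using that by (auto simp: boxes_in_def)
  let ?H = "convex hull (thick_boxes n) :: ((real ^ 'd) \<times> (real ^ 'd)) set"
  have "\<Inter>(insert ?H (boxes_in ` F)) \<noteq> {}"
  proof (rule Helly_le)
    show "finite (insert ?H (boxes_in ` F))" using fin by simp
    show "convex S" if "S \<in> insert ?H (boxes_in ` F)" for S
      using that conv by (auto intro: convex_boxes_in)
    fix \<G> assume \<G>: "\<G> \<subseteq> insert ?H (boxes_in ` F)"
      "card \<G> \<le> DIM((real ^ 'd) \<times> (real ^ 'd)) + 1"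
    show "\<Inter>\<G> \<noteq> {}"
    proof (cases "?H \<in> \<G>")
      case True
      obtain G where G: "G \<subseteq> F" "\<G> - {?H} = boxes_in ` G" "inj_on boxes_in G"
      proof -
        have "\<G> - {?H} \<subseteq> boxes_in ` F" using \<G>(1) by blast
        then show thesis using that unfolding subset_image_inj by metis
      qed
      have "card G = card (\<G> - {?H})" using G by (simp add: card_image)
      also have "\<dots> \<le> 2 * CARD('d)"
        using \<G>(2) True by (simp add: card_Diff_singleton)
      finally obtain z where "z \<in> thick_boxes n" "\<forall>C\<in>G. z \<in> boxes_in C"
        using ex[OF G(1)] by blast
      then have "z \<in> S" if "S \<in> \<G> - {?H}" for S
        using that unfolding G(2) by auto
      moreover have "z \<in> ?H" using \<open>z \<in> thick_boxes n\<close> by (rule hull_inc)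
      ultimately have "z \<in> \<Inter>\<G>" by blast
      then show ?thesis by blast
    next
      case False
      then have "(p, p) \<in> \<Inter>\<G>" using \<G>(1) p by blast
      then show ?thesis by blast
    qed
  qed
  then obtain z where "z \<in> \<Inter>(insert ?H (boxes_in ` F))" by blast
  then show thesis by (intro that[of z]) auto
qed

section \<open>Moving a box along a segment\<close>

lemma cbox_mono_cart:
  fixes a b x y :: "real ^ 'd"
  assumes "\<And>i. x $ i \<le> a $ i" "\<And>i. b $ i \<le> y $ i"
  shows "cbox a b \<subseteq> cbox x y"
proof
  fix t assume "t \<in> cbox a b"
  then have "x $ i \<le> t $ i" "t $ i \<le> y $ i" for i
    using assms[of i] order_trans by (auto simp: mem_box_cart)
  then show "t \<in> cbox x y" by (simp add: mem_box_cart)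
qed

text \<open>Take the last time \<open>L\<close> at which the moving box contains
  \<open>cbox a b\<close>. If no face touched and \<open>L < 1\<close>, all inequalities would be
  strict, an open condition, and the motion could continue.\<close>

lemma box_between:
  fixes z w :: "(real ^ 'd) \<times> (real ^ 'd)" and a b :: "real ^ 'd"
  assumes z: "cbox a b \<subseteq> cbox (fst z) (snd z)" and ab: "\<And>i. a $ i \<le> b $ i"
  obtains v where "v \<in> closed_segment z w" "\<And>i. fst v $ i \<le> a $ i" "\<And>i. b $ i \<le> snd v $ i"
    "v = w \<or> (\<exists>j. fst v $ j = a $ j \<or> snd v $ j = b $ j)"
proof -
  have "a \<in> cbox a b" "b \<in> cbox a b" using ab by (auto simp: mem_box_cart)
  with z have z': "fst z $ i \<le> a $ i" "b $ i \<le> snd z $ i" for i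
    by (auto simp: mem_box_cart subset_iff)
  define K where "K t = (1 - t) *\<^sub>R z + t *\<^sub>R w" for t
  have cont: "continuous_on A (\<lambda>t. fst (K t) $ i)" "continuous_on A (\<lambda>t. snd (K t) $ i)" for A i
    unfolding K_def by (intro continuous_intros)+
  define T where "T = {0..1} \<inter> {t. \<forall>i. fst (K t) $ i \<le> a $ i \<and> b $ i \<le> snd (K t) $ i}"
  have "closed {t. \<forall>i. fst (K t) $ i \<le> a $ i \<and> b $ i \<le> snd (K t) $ i}"
    by (intro closed_Collect_all closed_Collect_conj closed_Collect_le cont continuous_on_const)
  then have "compact T" unfolding T_def by (intro compact_Int_closed) auto
  moreover have "0 \<in> T" using z' by (simp add: T_def K_def)
  ultimately obtain L where L: "L \<in> T" "\<And>t. t \<in> T \<Longrightarrow> t \<le> L"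
    using compact_attains_sup[of T] by blast
  have "K L = w \<or> (\<exists>j. fst (K L) $ j = a $ j \<or> snd (K L) $ j = b $ j)"
  proof (rule ccontr)
    assume neg: "\<not> ?thesis"
    then have "L \<noteq> 1" by (auto simp: K_def)
    then have L1: "0 \<le> L" "L < 1" using L(1) by (auto simp: T_def)
    let ?O = "{t. \<forall>i. fst (K t) $ i < a $ i \<and> b $ i < snd (K t) $ i}"
    have "?O = (\<Inter>i. {t. fst (K t) $ i < a $ i} \<inter> {t. b $ i < snd (K t) $ i})" by auto
    also have "open \<dots>"
      by (intro open_INT ballI open_Int open_Collect_less cont continuous_on_const) auto
    finally have "open ?O" .
    moreover have "L \<in> ?O"
      using neg L(1) unfolding T_def less_le by (auto simp: eq_commute[of "b $ _"])
    ultimately obtain e where e: "0 < e" "ball L e \<subseteq> ?O"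
      using open_contains_ball by blast
    define t where "t = min 1 (L + e / 2)"
    have t: "L < t" "t \<le> 1" "t \<in> ball L e"
      using e(1) L1 by (auto simp: t_def dist_real_def)
    then have "t \<in> ?O" using e(2) by blast
    then have "t \<in> T" using t L1 by (auto simp: T_def less_imp_le)
    with L(2) t(1) show False by fastforce
  qed
  moreover have "K L \<in> closed_segment z w"
    using L(1) by (auto simp: closed_segment_def K_def T_def)
  ultimately show thesis using L(1) by (intro that[of "K L"]) (auto simp: T_def)
qed

section \<open>Excluding the enlarged lattice boxes\<close>

theorem theorem1p6:
  fixes F :: "(real ^ 'd) set set" and n :: nat
  assumes "n > 0"
    and "finite F"
    and "\<And>C. C \<in> F \<Longrightarrow> convex C"
    and "\<And>G. G \<subseteq> F \<Longrightarrow> card G \<le> 2 * CARD('d) \<Longrightarrow>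
           \<exists>B. thick_box 1 B \<and> B \<subseteq> \<Inter>G \<and> n \<le> card (B \<inter> integer_points)"
  shows "\<exists>B. axis_parallel_box B \<and> B \<subseteq> \<Inter>F \<and>
           real n / 3 ^ (CARD('d) - 1) \<le> real (card (B \<inter> integer_points))"
proof (rule ccontr)
  assume neg: "\<not> ?thesis"
  have ex: "\<exists>z \<in> thick_boxes n. \<forall>C\<in>G. z \<in> boxes_in C"
    if G: "G \<subseteq> F" "card G \<le> 2 * CARD('d)" for G
  proof -
    obtain x y where "\<forall>i. x $ i \<le> y $ i" "\<forall>i. 1 \<le> y $ i - x $ i" "cbox x y \<subseteq> \<Inter>G"
      "n \<le> card (cbox x y \<inter> integer_points)"
      using assms(4)[OF G] by (auto simp: thick_box_def)
    then have "(x, y) \<in> thick_boxes n" "\<forall>C\<in>G. (x, y) \<in> boxes_in C"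
      by (auto simp: thick_boxes_def boxes_in_def)
    then show ?thesis by blast
  qed
  obtain z where z: "z \<in> convex hull (thick_boxes n)" "\<And>C. C \<in> F \<Longrightarrow> z \<in> boxes_in C"
    using common_box[OF assms(2,3) ex] by blast
  define a where "a i = \<lceil>fst z $ i\<rceil>" for i
  define b where "b i = \<lfloor>snd z $ i\<rfloor>" for i
  define c where "c i = nat (b i - a i + 1)" for i
  define lbox where "lbox a b = cbox (\<chi> i. real_of_int (a i)) (\<chi> i. of_int (b i))"
    for a b :: "'d \<Rightarrow> int"
  \<comment> \<open>A side of length at least 1 contains an integer, so the lattice box is
    nonempty.\<close>
  have ab: "a i \<le> b i" for i
    using thick_convex_hull_side[OF z(1), of i] unfolding a_def b_def by linarith
  have c1: "1 \<le> c i" for i using ab[of i] by (simp add: c_def)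
  have rc: "real (c i) = of_int (b i) - of_int (a i) + 1" for i
    using ab[of i] by (simp add: c_def)
  have side: "snd z $ i - fst z $ i < real (c i) + 1" for i
    unfolding rc a_def b_def by linarith
  have boxF: "lbox a b \<subseteq> C" if "C \<in> F" for C
  proof -
    have "lbox a b \<subseteq> cbox (fst z) (snd z)"
      unfolding lbox_def by (rule cbox_mono_cart) (auto simp: a_def b_def)
    then show ?thesis using z(2)[OF that] by (auto simp: boxes_in_def)
  qed
  have small: "3 ^ (CARD('d) - 1) * (\<Prod>i\<in>UNIV. nat (b' i - a' i + 1)) < n"
    if "\<And>i. a' i \<le> b' i" "lbox a' b' \<subseteq> \<Inter>F" for a' b'
  proof -
    have "axis_parallel_box (lbox a' b')"
      unfolding axis_parallel_box_def lbox_def using that(1)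
      by (intro exI[of _ "\<chi> i. of_int (a' i)"] exI[of _ "\<chi> i. of_int (b' i)"]) auto
    then have "real (card (lbox a' b' \<inter> integer_points)) < real n / 3 ^ (CARD('d) - 1)"
      using neg that(2) not_le by blast
    then have "3 ^ (CARD('d) - 1) * real (card (lbox a' b' \<inter> integer_points)) < real n"
      by (simp add: field_simps)
    then have "real (3 ^ (CARD('d) - 1) * card (lbox a' b' \<inter> integer_points)) < real n"
      by simp
    then show ?thesis
      by (simp only: of_nat_less_iff) (simp add: lbox_def card_integer_points_cbox)
  qed
  \<comment> \<open>An added layer would change the factor \<open>c j\<close> to
    \<open>c j + 1\<close>, so \<open>small\<close> would contradict the hull bound for
    \<open>z\<close>.\<close>
  have "\<exists>C\<in>F. \<not> lbox a (b(j := b j + 1)) \<subseteq> C" for j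
  proof (rule ccontr)
    assume "\<not> ?thesis"
    then have sub: "lbox a (b(j := b j + 1)) \<subseteq> \<Inter>F" by blast
    have "3 ^ (CARD('d) - 1) * (\<Prod>i\<in>UNIV. nat ((b(j := b j + 1)) i - a i + 1)) < n"
    proof (rule small[OF _ sub])
      show "a i \<le> (b(j := b j + 1)) i" for i using ab[of i] by auto
    qed
    also have "(\<Prod>i\<in>UNIV. nat ((b(j := b j + 1)) i - a i + 1)) = (c j + 1) * (\<Prod>i\<in>UNIV - {j}. c i)"
      using ab[of j] by (subst prod.remove[of UNIV j]) (auto simp: c_def nat_add_distrib intro!: prod.cong)
    finally show False
      using thick_convex_hull_bound[OF z(1) c1 side, of j] by simp
  qed
  then obtain U where U: "\<And>j. U j \<in> F" "\<And>j. \<not> lbox a (b(j := b j + 1)) \<subseteq> U j" by metis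
  have "\<exists>C\<in>F. \<not> lbox (a(j := a j - 1)) b \<subseteq> C" for j
  proof (rule ccontr)
    assume "\<not> ?thesis"
    then have sub: "lbox (a(j := a j - 1)) b \<subseteq> \<Inter>F" by blast
    have "3 ^ (CARD('d) - 1) * (\<Prod>i\<in>UNIV. nat (b i - (a(j := a j - 1)) i + 1)) < n"
    proof (rule small[OF _ sub])
      show "(a(j := a j - 1)) i \<le> b i" for i using ab[of i] by auto
    qed
    also have "(\<Prod>i\<in>UNIV. nat (b i - (a(j := a j - 1)) i + 1)) = (c j + 1) * (\<Prod>i\<in>UNIV - {j}. c i)"
      using ab[of j] by (subst prod.remove[of UNIV j]) (auto simp: c_def nat_add_distrib intro!: prod.cong)
    finally show False
      using thick_convex_hull_bound[OF z(1) c1 side, of j] by simp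
  qed
  then obtain D where D: "\<And>j. D j \<in> F" "\<And>j. \<not> lbox (a(j := a j - 1)) b \<subseteq> D j" by metis
  have "card (range U \<union> range D) \<le> card (range U) + card (range D)"
    by (rule card_Un_le)
  also have "\<dots> \<le> 2 * CARD('d)"
    using card_image_le[of UNIV U] card_image_le[of UNIV D] by simp
  finally obtain w where w: "w \<in> thick_boxes n" "\<forall>C\<in>range U \<union> range D. w \<in> boxes_in C"
    using ex[of "range U \<union> range D"] U(1) D(1) by blast
  obtain v where v: "v \<in> closed_segment z w"
    and va: "\<And>i. fst v $ i \<le> of_int (a i)" and vb: "\<And>i. of_int (b i) \<le> snd v $ i"
    and stop: "v = w \<or> (\<exists>j. fst v $ j = of_int (a j) \<or> snd v $ j = of_int (b j))"
  proof (rule box_between[of "\<chi> i. of_int (a i)" "\<chi> i. of_int (b i)" z w])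
    show "cbox (\<chi> i. of_int (a i)) (\<chi> i. of_int (b i)) \<subseteq> cbox (fst z) (snd z)"
      by (rule cbox_mono_cart) (auto simp: a_def b_def)
  qed (use ab in auto)
  \<comment> \<open>Though \<open>v\<close> itself need not contain \<open>n\<close> lattice points,
    the hull bound applies to it.\<close>
  have vH: "v \<in> convex hull (thick_boxes n)"
    using closed_segment_subset[OF z(1) hull_inc[OF w(1)] convex_convex_hull] v by blast
  have vG: "cbox (fst v) (snd v) \<subseteq> C" if "C \<in> range U \<union> range D" for C
  proof -
    have "C \<in> F" using that U(1) D(1) by blast
    then have "closed_segment z w \<subseteq> boxes_in C"
      using z(2) w(2) that assms(3) by (intro closed_segment_subset convex_boxes_in) auto
    then show ?thesis using v by (auto simp: boxes_in_def)
  qed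
  \<comment> \<open>The box of \<open>v\<close> lies in \<open>U j\<close>, which excludes the added
    upper layer.\<close>
  have up: "snd v $ j < of_int (b j) + 1" for j
  proof (rule ccontr)
    assume "\<not> ?thesis"
    then have "lbox a (b(j := b j + 1)) \<subseteq> cbox (fst v) (snd v)"
      unfolding lbox_def using va vb by (intro cbox_mono_cart) auto
    then show False using vG[of "U j"] U(2)[of j] by blast
  qed
  have down: "of_int (a j) - 1 < fst v $ j" for j
  proof (rule ccontr)
    assume "\<not> ?thesis"
    then have "lbox (a(j := a j - 1)) b \<subseteq> cbox (fst v) (snd v)"
      unfolding lbox_def using va vb by (intro cbox_mono_cart) auto
    then show False using vG[of "D j"] D(2)[of j] by blast
  qed
  have c: "3 ^ (CARD('d) - 1) * (\<Prod>i\<in>UNIV. c i) < n"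
    unfolding c_def by (rule small[OF ab]) (use boxF in blast)
  show False
  proof (cases "v = w")
    case True
    have "\<lfloor>snd v $ i\<rfloor> = b i" "\<lceil>fst v $ i\<rceil> = a i" for i
      using va[of i] vb[of i] up[of i] down[of i] by (auto simp: floor_eq_iff ceiling_eq_iff)
    then have "n \<le> (\<Prod>i\<in>UNIV. c i)"
      using w(1) True by (simp add: thick_boxes_def card_integer_points_cbox c_def)
    also have "\<dots> \<le> 3 ^ (CARD('d) - 1) * (\<Prod>i\<in>UNIV. c i)" by simp
    finally show False using c by simp
  next
    case False
    with stop obtain j where j: "fst v $ j = of_int (a j) \<or> snd v $ j = of_int (b j)" by blast
    \<comment> \<open>One face lies on the lattice box and the opposite one is less than 1 beyond
      it.\<close>
    have vj: "snd v $ j - fst v $ j < real (c j)"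
      using j up[of j] down[of j] unfolding rc by linarith
    moreover have "1 \<le> snd v $ j - fst v $ j" by (rule thick_convex_hull_side[OF vH])
    ultimately have cj: "2 \<le> c j" by linarith
    \<comment> \<open>The factor \<open>c' j + 1\<close> in the hull bound is again
      \<open>c j\<close>, so the bound becomes the full product of \<open>c\<close>, contradicting
      \<open>c\<close>; \<open>cj\<close> keeps \<open>c' j\<close> positive.\<close>
    define c' where "c' = c(j := c j - 1)"
    have "n \<le> 3 ^ (CARD('d) - 1) * ((c' j + 1) * (\<Prod>i\<in>UNIV - {j}. c' i))"
    proof (rule thick_convex_hull_bound[OF vH])
      show "1 \<le> c' i" for i using cj c1[of i] by (auto simp: c'_def)
      show "snd v $ i - fst v $ i < real (c' i) + 1" for i
      proof (cases "i = j")
        case True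
        then show ?thesis using vj cj by (simp add: c'_def of_nat_diff)
      next
        case False
        then have "real (c' i) = of_int (b i) - of_int (a i) + 1" by (simp add: c'_def rc)
        then show ?thesis using up[of i] down[of i] by linarith
      qed
    qed
    also have "(c' j + 1) * (\<Prod>i\<in>UNIV - {j}. c' i) = (\<Prod>i\<in>UNIV. c i)"
      using cj by (subst prod.remove[of UNIV j]) (auto simp: c'_def intro!: prod.cong)
    finally show False using c by simp
  qed
qed

end
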